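(* Let $\mathcal{C}$ be a small category and let $R$ be a (commutative, zero-sum-free) semifield. Then the simplicial set $D_R(N\mathcal{C})$ is a compository, i.e. it can be equipped with composition operations satisfying the axioms of a compository.
   Context: A semifield is a commutative semiring with $0\ne1$ in which every non-zero element has a multiplicative inverse; zero-sum-free means $a+b=0$ implies $a=b=0$. For a set $S$, $D_R(S)$ is the set of finitely supported functions $p:S\to R$ with $\sum_s p(s)=1$, functorial by pushforward $D_R(f)(p)(s')=\sum_{f(s)=s'}p(s)$; for a simplicial set $Y$, $D_R(Y)$ is obtained by applying $D_R$ degreewise. $N\mathcal{C}$ is the nerve of $\mathcal{C}$. For $k\le n$ let $S^k:[k]\to[n]$, $S^k(i)=i$, and $T^k:[k]\to[n]$, $T^k(i)=i+n-k$; for a simplicial set $Z$ write $S_k=(S^k)^*,T_k=(T^k)^*:Z_n\to Z_k$. A pair $(x,y)\in Z_m\times Z_n$ is $k$-composable ($0\le k\le \min(m,n)$) if $T_k(x)=S_k(y)$. A compository is a simplicial set $Z$ with, for every $k\in\mathbb{N}$ and every $k$-composable pair $(x,y)\in Z_m\times Z_n$, a composition $x\circ_k y\in Z_{m+n-k}$ such that: (a) Identity: if $k=n$ then $x\circ_n y=x$; if $k=m$ then $x\circ_m y=y$. (b) Back-and-forth: if $(x,y)\in Z_m\times Z_n$ is $k$-composable and $z=x\circ_k y\in Z_j$, $j=m+n-k$, then for every $\tilde m$ with $m\le \tilde m\le j$, $S_{\tilde m}(z)\circ_{\tilde m+n-j}y=z$ whenever $\tilde m+n-j\le n$, and for every $\tilde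 n$ with $n\le\tilde n\le j$, $x\circ_{m+\tilde n-j}T_{\tilde n}(z)=z$. (That these pairs are composable is part of the assertion.) (c) Partial naturality: if $(x,y)\in Z_m\times Z_n$ is $k$-composable and $f:[m']\to[m]$, $g:[n']\to[n]$ are order-preserving maps with $f\circ T^k=T^k$ and $g\circ S^k=S^k$ (where $k\le m',n'$), then $f^*(x)\circ_k g^*(y)=h^*(x\circ_k y)$, where $h:[m'+n'-k]\to[m+n-k]$ is the order-preserving map obtained by gluing $f$ and $g$ along the common $[k]$, that is $h\circ S^{m'}=S^{m}\circ f$ and $h\circ T^{n'}=T^{n}\circ g$ (such an $h$ is required to be order preserving). *)

theory Defs
  imports Main "HOL-Library.FuncSet"
begin

section \<open>Semifields\<close>

class semifield = comm_semiring_1 +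
  assumes ex_mult_inverse: "a \<noteq> 0 \<Longrightarrow> \<exists>b. a * b = 1"

class zero_sum_free_semifield = semifield +
  assumes zero_sum_free: "a + b = 0 \<Longrightarrow> a = 0 \<and> b = 0"


section \<open>Small categories and functors\<close>

text \<open>\<open>Comp C g f\<close> is the composite of \<open>g\<close> after \<open>f\<close>.\<close>

record ('o, 'm) cat =
  Obj :: "'o set"
  Mor :: "'m set"
  Dom :: "'m \<Rightarrow> 'o"
  Cod :: "'m \<Rightarrow> 'o"
  Ident :: "'o \<Rightarrow> 'm"
  Comp :: "'m \<Rightarrow> 'm \<Rightarrow> 'm"

locale small_category =
  fixes C :: "('o, 'm) cat"
  assumes Dom_in_Obj: "f \<in> Mor C \<Longrightarrow> Dom C f \<in> Obj C"
    and Cod_in_Obj: "f \<in> Mor C \<Longrightarrow> Cod C f \<in> Obj C"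
    and Ident_in_Mor: "a \<in> Obj C \<Longrightarrow> Ident C a \<in> Mor C"
    and Dom_Ident: "a \<in> Obj C \<Longrightarrow> Dom C (Ident C a) = a"
    and Cod_Ident: "a \<in> Obj C \<Longrightarrow> Cod C (Ident C a) = a"
    and Comp_in_Mor:
      "\<lbrakk>f \<in> Mor C; g \<in> Mor C; Cod C f = Dom C g\<rbrakk> \<Longrightarrow> Comp C g f \<in> Mor C"
    and Dom_Comp:
      "\<lbrakk>f \<in> Mor C; g \<in> Mor C; Cod C f = Dom C g\<rbrakk> \<Longrightarrow> Dom C (Comp C g f) = Dom C f"
    and Cod_Comp:
      "\<lbrakk>f \<in> Mor C; g \<in> Mor C; Cod C f = Dom C g\<rbrakk> \<Longrightarrow> Cod C (Comp C g f) = Cod C g"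
    and Comp_Ident_right: "f \<in> Mor C \<Longrightarrow> Comp C f (Ident C (Dom C f)) = f"
    and Comp_Ident_left: "f \<in> Mor C \<Longrightarrow> Comp C (Ident C (Cod C f)) f = f"
    and Comp_assoc:
      "\<lbrakk>f \<in> Mor C; g \<in> Mor C; h \<in> Mor C; Cod C f = Dom C g; Cod C g = Dom C h\<rbrakk>
        \<Longrightarrow> Comp C h (Comp C g f) = Comp C (Comp C h g) f"

text \<open>
  A functor is a pair of its object and morphism parts. Both are extensional functions, so
  that equality of functors is equality in HOL.
\<close>

definition functors ::
    "('o, 'm) cat \<Rightarrow> ('p, 'n) cat \<Rightarrow> (('o \<Rightarrow> 'p) \<times> ('m \<Rightarrow> 'n)) set" where
  "functors A B = {(F, G).
     F \<in> Obj A \<rightarrow>\<^sub>E Obj B \<and> G \<in> Mor A \<rightarrow>\<^sub>E Mor B \<and>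
     (\<forall>f \<in> Mor A. Dom B (G f) = F (Dom A f) \<and> Cod B (G f) = F (Cod A f)) \<and>
     (\<forall>a \<in> Obj A. G (Ident A a) = Ident B (F a)) \<and>
     (\<forall>f \<in> Mor A. \<forall>g \<in> Mor A. Cod A f = Dom A g \<longrightarrow>
        G (Comp A g f) = Comp B (G g) (G f))}"

definition ord_cat :: "nat \<Rightarrow> (nat, nat \<times> nat) cat" where
  "ord_cat n = \<lparr>
     Obj = {..n},
     Mor = {(i, j). i \<le> j \<and> j \<le> n},
     Dom = fst,
     Cod = snd,
     Ident = (\<lambda>i. (i, i)),
     Comp = (\<lambda>g f. (fst f, snd g))\<rparr>"


section \<open>Simplicial sets\<close>

text \<open>
  The order-preserving maps \<open>[m] \<rightarrow> [n]\<close>, where \<open>[n] = {0, \<dots>, n}\<close>, are represented by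
  functions that are \<^const>\<open>undefined\<close> outside of \<open>[m]\<close>. Their composition is
  \<^const>\<open>compose\<close>.
\<close>

definition delta :: "nat \<Rightarrow> nat \<Rightarrow> (nat \<Rightarrow> nat) set" where
  "delta m n = {f \<in> {..m} \<rightarrow>\<^sub>E {..n}. mono_on {..m} f}"

text \<open>
  \<open>act Z m n f\<close> is the map \<open>f\<^sup>*\<close> from \<open>n\<close>-simplices to \<open>m\<close>-simplices
  induced by \<open>f : [m] \<rightarrow> [n]\<close>. The sets of simplices in different dimensions need not
  be disjoint, so operations on simplices take the dimensions as arguments.
\<close>

record 'a sset =
  simplices :: "nat \<Rightarrow> 'a set"
  act :: "nat \<Rightarrow> nat \<Rightarrow> (nat \<Rightarrow> nat) \<Rightarrow> 'a \<Rightarrow> 'a"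

locale simplicial_set =
  fixes Z :: "'a sset"
  assumes act_closed: "\<lbrakk>f \<in> delta m n; x \<in> simplices Z n\<rbrakk> \<Longrightarrow> act Z m n f x \<in> simplices Z m"
    and act_id: "x \<in> simplices Z n \<Longrightarrow> act Z n n (\<lambda>i\<in>{..n}. i) x = x"
    and act_compose:
      "\<lbrakk>f \<in> delta l m; g \<in> delta m n; x \<in> simplices Z n\<rbrakk>
        \<Longrightarrow> act Z l n (compose {..l} g f) x = act Z l m f (act Z m n g x)"

text \<open>An order-preserving map \<open>f : [m] \<rightarrow> [n]\<close> acts on functors by precomposition.\<close>

definition nerve ::
    "('o, 'm) cat \<Rightarrow> ((nat \<Rightarrow> 'o) \<times> (nat \<times> nat \<Rightarrow> 'm)) sset" where
  "nerve C = \<lparr>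
     simplices = (\<lambda>n. functors (ord_cat n) C),
     act = (\<lambda>m n f (F, G).
       (compose (Obj (ord_cat m)) F f,
        compose (Mor (ord_cat m)) G (\<lambda>(i, j). (f i, f j))))\<rparr>"


section \<open>Distributions\<close>

text \<open>A function \<open>S \<rightarrow> R\<close> is extended by zero to the ambient type of \<open>S\<close>.\<close>

definition dist :: "'a set \<Rightarrow> ('a \<Rightarrow> 'r::comm_semiring_1) set" where
  "dist S = {p. {s. p s \<noteq> 0} \<subseteq> S \<and> finite {s. p s \<noteq> 0} \<and> (\<Sum>s | p s \<noteq> 0. p s) = 1}"

definition dist_map :: "('a \<Rightarrow> 'b) \<Rightarrow> ('a \<Rightarrow> 'r::comm_semiring_1) \<Rightarrow> 'b \<Rightarrow> 'r" where
  "dist_map f p = (\<lambda>t. \<Sum>s | p s \<noteq> 0 \<and> f s = t. p s)"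

definition dist_sset :: "'a sset \<Rightarrow> ('a \<Rightarrow> 'r::comm_semiring_1) sset" where
  "dist_sset Y = \<lparr>
     simplices = (\<lambda>n. dist (simplices Y n)),
     act = (\<lambda>m n f. dist_map (act Y m n f))\<rparr>"


section \<open>Compositories\<close>

definition src_map :: "nat \<Rightarrow> nat \<Rightarrow> nat" where
  "src_map k = (\<lambda>i\<in>{..k}. i)"

definition tgt_map :: "nat \<Rightarrow> nat \<Rightarrow> nat \<Rightarrow> nat" where
  "tgt_map n k = (\<lambda>i\<in>{..k}. i + (n - k))"

definition src :: "'a sset \<Rightarrow> nat \<Rightarrow> nat \<Rightarrow> 'a \<Rightarrow> 'a" where
  "src Z n k = act Z k n (src_map k)"

definition tgt :: "'a sset \<Rightarrow> nat \<Rightarrow> nat \<Rightarrow> 'a \<Rightarrow> 'a" where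
  "tgt Z n k = act Z k n (tgt_map n k)"

definition composable :: "'a sset \<Rightarrow> nat \<Rightarrow> nat \<Rightarrow> nat \<Rightarrow> 'a \<Rightarrow> 'a \<Rightarrow> bool" where
  "composable Z m n k x y \<longleftrightarrow>
     k \<le> m \<and> k \<le> n \<and> x \<in> simplices Z m \<and> y \<in> simplices Z n \<and> tgt Z m k x = src Z n k y"

text \<open>
  \<open>comp m n k x y\<close> is the composition of \<open>x \<in> Z\<^sub>m\<close> and \<open>y \<in> Z\<^sub>n\<close> along \<open>k\<close>; its value
  matters only on composable pairs. Every axiom that composes a pair other than the given
  one also asserts that this pair is composable. In \<open>naturality\<close>, the map \<open>h\<close> exists and
  is uniquely determined by the two gluing equations.
\<close>

locale compository = simplicial_set Z
  for Z :: "'a sset" +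
  fixes comp :: "nat \<Rightarrow> nat \<Rightarrow> nat \<Rightarrow> 'a \<Rightarrow> 'a \<Rightarrow> 'a"
  assumes comp_closed:
      "composable Z m n k x y \<Longrightarrow> comp m n k x y \<in> simplices Z (m + n - k)"
    and identity_right: "composable Z m n n x y \<Longrightarrow> comp m n n x y = x"
    and identity_left: "composable Z m n m x y \<Longrightarrow> comp m n m x y = y"
    and back_and_forth_src:
      "\<lbrakk>composable Z m n k x y; j = m + n - k; z = comp m n k x y; m \<le> m'; m' \<le> j\<rbrakk>
        \<Longrightarrow> composable Z m' n (m' + n - j) (src Z j m' z) y \<and>
            comp m' n (m' + n - j) (src Z j m' z) y = z"
    and back_and_forth_tgt:
      "\<lbrakk>composable Z m n k x y; j = m + n - k; z = comp m n k x y; n \<le> n'; n' \<le> j\<rbrakk>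
        \<Longrightarrow> composable Z m n' (m + n' - j) x (tgt Z j n' z) \<and>
            comp m n' (m + n' - j) x (tgt Z j n' z) = z"
    and naturality:
      "\<lbrakk>composable Z m n k x y; k \<le> m'; k \<le> n'; f \<in> delta m' m; g \<in> delta n' n;
        compose {..k} f (tgt_map m' k) = tgt_map m k;
        compose {..k} g (src_map k) = src_map k;
        h \<in> delta (m' + n' - k) (m + n - k);
        compose {..m'} h (src_map m') = compose {..m'} (src_map m) f;
        compose {..n'} h (tgt_map (m' + n' - k) n') =
          compose {..n'} (tgt_map (m + n - k) n) g\<rbrakk>
        \<Longrightarrow> composable Z m' n' k (act Z m' m f x) (act Z n' n g y) \<and>
            comp m' n' k (act Z m' m f x) (act Z n' n g y) =
              act Z (m' + n' - k) (m + n - k) h (comp m n k x y)"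

end

theory Submission
  imports Defs
begin

text \<open>
  In the nerve, an \<open>m\<close>-simplex and an \<open>n\<close>-simplex that agree on a common \<open>[k]\<close> glue to a
  unique \<open>(m + n - k)\<close>-simplex. For distributions \<open>p\<close> and \<open>q\<close> with the same marginal \<open>r\<close> on the
  overlap, composition is the conditional product: the glueing \<open>z\<close> of \<open>x\<close> and \<open>y\<close>
  gets the weight \<open>p x * q y / r c\<close>, where \<open>c\<close> is the overlap of \<open>x\<close> and \<open>y\<close>; if \<open>r c = 0\<close>, then
  zero-sum-freeness forces \<open>p x = q y = 0\<close>. Naturality is a reindexing of sums along the
  bijection \<open>z \<mapsto> (x, y)\<close>: the maps in question fix the overlap, so the denominator is constant on
  the fibres. Naturality for the face maps \<open>S\<close> and \<open>T\<close> says that the faces of a composite are again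
  composites; this yields its marginals, hence its total mass, and reduces back-and-forth
  to cancelling the marginal of one factor.
\<close>

section \<open>Semifields\<close>

text \<open>The class asserts only that inverses exist, so one is picked by choice.\<close>

definition sf_inverse :: "'a::semifield \<Rightarrow> 'a" where
  "sf_inverse a = (SOME b. a * b = 1)"

lemma mult_sf_inverse: "a * sf_inverse a = 1" if "a \<noteq> 0" for a :: "'a::semifield"
  unfolding sf_inverse_def by (rule someI_ex) (rule ex_mult_inverse[OF that])

text \<open>Terms are split off one at a time; zero-sum-freeness makes both pieces of a vanishing
  sum vanish.\<close>

lemma sum_eq_0D:
  fixes p :: "'a \<Rightarrow> 'r::zero_sum_free_semifield"
  assumes "finite A" "sum p A = 0" "s \<in> A"
  shows "p s = 0"
  using assms by (induction A) (auto dest: zero_sum_free)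


section \<open>Distributions\<close>

lemma finite_dist: "p \<in> dist S \<Longrightarrow> finite {s. p s \<noteq> 0}"
  by (simp add: dist_def)

lemma dist_nonzeroD: "p \<in> dist S \<Longrightarrow> p s \<noteq> 0 \<Longrightarrow> s \<in> S"
  by (auto simp: dist_def)

text \<open>Points outside the support contribute zero, so fibres may be summed inside any finite
  set containing the support.\<close>

lemma dist_map_eq_sum:
  assumes "finite A" "{s. p s \<noteq> 0} \<subseteq> A"
  shows "dist_map f p t = (\<Sum>s | s \<in> A \<and> f s = t. p s)"
  unfolding dist_map_def by (rule sum.mono_neutral_left) (use assms in auto)

text \<open>Only an inclusion holds at this generality: values over a fibre may cancel in a semiring
  that is not zero-sum-free.\<close>

lemma dist_map_nonzero_subset: "{t. dist_map f p t \<noteq> 0} \<subseteq> f ` {s. p s \<noteq> 0}"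
proof
  fix t assume "t \<in> {t. dist_map f p t \<noteq> 0}"
  then have "{s. p s \<noteq> 0 \<and> f s = t} \<noteq> {}"
    by (auto simp: dist_map_def simp del: Collect_empty_eq)
  then show "t \<in> f ` {s. p s \<noteq> 0}"
    by blast
qed

lemma sum_dist_map:
  assumes "finite {s. p s \<noteq> 0}"
  shows "(\<Sum>t | dist_map f p t \<noteq> 0. dist_map f p t) = (\<Sum>s | p s \<noteq> 0. p s)"
proof -
  have "(\<Sum>t | dist_map f p t \<noteq> 0. dist_map f p t) =
      (\<Sum>t \<in> f ` {s. p s \<noteq> 0}. dist_map f p t)"
    by (rule sum.mono_neutral_left) (use assms dist_map_nonzero_subset[of f p] in auto)
  also have "\<dots> = (\<Sum>s | p s \<noteq> 0. p s)"
    using sum.image_gen[OF assms, of p f] by (simp add: dist_map_def)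
  finally show ?thesis .
qed

lemma dist_map_in_dist:
  assumes "p \<in> dist S" "\<And>s. s \<in> S \<Longrightarrow> f s \<in> T"
  shows "dist_map f p \<in> dist T"
proof -
  have "{t. dist_map f p t \<noteq> 0} \<subseteq> T"
    using dist_map_nonzero_subset[of f p] assms by (auto simp: dist_def)
  moreover have "finite {t. dist_map f p t \<noteq> 0}"
    using dist_map_nonzero_subset finite_dist[OF assms(1)] by (rule finite_surj[rotated])
  ultimately show ?thesis
    using sum_dist_map[OF finite_dist[OF assms(1)], of f] assms(1) by (simp add: dist_def)
qed

text \<open>The fibre of the composite over \<open>t\<close> is partitioned by \<open>f\<close> into
  its fibres over the points \<open>u\<close> with \<open>g u = t\<close>.\<close>

lemma dist_map_compose:
  assumes fin: "finite {s. p s \<noteq> 0}"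
  shows "dist_map g (dist_map f p) = dist_map (\<lambda>s. g (f s)) p"
proof
  fix t
  let ?A = "{s. p s \<noteq> 0}"
  let ?S = "{s. p s \<noteq> 0 \<and> g (f s) = t}" and ?T = "{u. u \<in> f ` ?A \<and> g u = t}"
  have "dist_map g (dist_map f p) t = (\<Sum>u \<in> ?T. dist_map f p u)"
    by (rule dist_map_eq_sum) (use fin dist_map_nonzero_subset[of f p] in auto)
  also have "\<dots> = (\<Sum>u \<in> ?T. \<Sum>s | s \<in> ?S \<and> f s = u. p s)"
    unfolding dist_map_def by (intro sum.cong refl) auto
  also have "\<dots> = sum p ?S"
    by (rule sum.group) (use fin in auto)
  finally show "dist_map g (dist_map f p) t = dist_map (\<lambda>s. g (f s)) p t"
    by (simp add: dist_map_def)
qed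

lemma dist_map_cong:
  assumes "p \<in> dist S" "\<And>s. s \<in> S \<Longrightarrow> f s = g s"
  shows "dist_map f p = dist_map g p"
  unfolding dist_map_def using assms
  by (intro ext sum.cong) (auto dest: dist_nonzeroD)

lemma dist_map_ident:
  assumes "p \<in> dist S" "\<And>s. s \<in> S \<Longrightarrow> f s = s"
  shows "dist_map f p = p"
proof
  fix t
  have "{s. p s \<noteq> 0 \<and> f s = t} = (if p t = 0 then {} else {t})"
    using assms by (auto dest: dist_nonzeroD)
  then show "dist_map f p t = p t"
    by (simp add: dist_map_def)
qed

text \<open>\<open>p s\<close> is one of the terms summed in the marginal at \<open>f s\<close>.
  This settles every case of a vanishing denominator below.\<close>

lemma dist_map_eq_0D:
  fixes p :: "'a \<Rightarrow> 'r::zero_sum_free_semifield"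
  assumes "p \<in> dist S" "dist_map f p (f s) = 0"
  shows "p s = 0"
proof (rule ccontr)
  assume "p s \<noteq> 0"
  \<comment> \<open>The sum runs over nonzero values only, so \<open>s\<close> is one of its indices
    just under the assumption \<open>p s \<noteq> 0\<close>.\<close>
  then have "p s = 0"
    by (intro sum_eq_0D[OF _ assms(2)[unfolded dist_map_def]])
      (use finite_dist[OF assms(1)] in auto)
  with \<open>p s \<noteq> 0\<close> show False ..
qed


section \<open>Simplicial identities\<close>

lemma src_map_in_delta: "k \<le> n \<Longrightarrow> src_map k \<in> delta k n"
  by (auto simp: src_map_def delta_def mono_on_def)

lemma tgt_map_in_delta: "k \<le> n \<Longrightarrow> tgt_map n k \<in> delta k n"
  by (auto simp: tgt_map_def delta_def mono_on_def)

lemma compose_src_src: "k \<le> m \<Longrightarrow> compose {..k} (src_map m) (src_map k) = src_map k"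
  by (auto simp: src_map_def compose_def fun_eq_iff)

lemma compose_tgt_tgt:
  "k \<le> m \<Longrightarrow> m \<le> n \<Longrightarrow> compose {..k} (tgt_map n m) (tgt_map m k) = tgt_map n k"
  by (auto simp: tgt_map_def compose_def fun_eq_iff)

text \<open>Inside \<open>[m + n - k]\<close>, the end of the initial \<open>[m]\<close> and the
  start of the final \<open>[n]\<close> are the same \<open>[k]\<close>: both sides send
  \<open>i\<close> to \<open>i + (m - k)\<close>.\<close>

lemma compose_src_tgt:
  assumes "k \<le> m" "k \<le> n"
  shows "compose {..k} (src_map m) (tgt_map m k) =
    compose {..k} (tgt_map (m + n - k) n) (src_map k)"
  using assms by (auto simp: src_map_def tgt_map_def compose_def fun_eq_iff)

lemma tgt_map_self: "tgt_map n n = src_map n"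
  by (simp add: tgt_map_def src_map_def)

context simplicial_set
begin

lemma src_closed: "x \<in> simplices Z n \<Longrightarrow> k \<le> n \<Longrightarrow> src Z n k x \<in> simplices Z k"
  unfolding src_def by (rule act_closed[OF src_map_in_delta])

lemma tgt_closed: "x \<in> simplices Z n \<Longrightarrow> k \<le> n \<Longrightarrow> tgt Z n k x \<in> simplices Z k"
  unfolding tgt_def by (rule act_closed[OF tgt_map_in_delta])

lemma src_self: "x \<in> simplices Z n \<Longrightarrow> src Z n n x = x"
  using act_id by (simp add: src_def src_map_def)

lemma tgt_self: "x \<in> simplices Z n \<Longrightarrow> tgt Z n n x = x"
  using src_self by (simp add: tgt_def src_def tgt_map_self)

lemma src_src:
  "x \<in> simplices Z n \<Longrightarrow> k \<le> m \<Longrightarrow> m \<le> n \<Longrightarrow> src Z m k (src Z n m x) = src Z n k x"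
  using act_compose[OF src_map_in_delta src_map_in_delta, of k m n x]
  by (simp add: src_def compose_src_src)

lemma tgt_tgt:
  "x \<in> simplices Z n \<Longrightarrow> k \<le> m \<Longrightarrow> m \<le> n \<Longrightarrow> tgt Z m k (tgt Z n m x) = tgt Z n k x"
  using act_compose[OF tgt_map_in_delta tgt_map_in_delta, of k m n x]
  by (simp add: tgt_def compose_tgt_tgt)

lemma act_square:
  assumes "x \<in> simplices Z n" "f \<in> delta k m" "g \<in> delta m n" "f' \<in> delta k m'" "g' \<in> delta m' n"
    "compose {..k} g f = compose {..k} g' f'"
  shows "act Z k m f (act Z m n g x) = act Z k m' f' (act Z m' n g' x)"
  using assms by (metis act_compose)

lemma tgt_src:
  assumes "k \<le> m" "k \<le> n" "j = m + n - k" "z \<in> simplices Z j"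
  shows "tgt Z m k (src Z j m z) = src Z n k (tgt Z j n z)"
  unfolding src_def tgt_def using assms compose_src_tgt[OF assms(1,2)]
  by (intro act_square src_map_in_delta tgt_map_in_delta) auto

text \<open>A map that fixes the final \<open>[k]\<close> does not move the overlap. This and
  \<open>src_act\<close> are applied both to simplices of \<open>Y\<close> and to distributions on
  them.\<close>

lemma tgt_act:
  assumes "x \<in> simplices Z m" "f \<in> delta m' m" "k \<le> m'" "compose {..k} f (tgt_map m' k) = tgt_map m k"
  shows "tgt Z m' k (act Z m' m f x) = tgt Z m k x"
  using assms act_compose[OF tgt_map_in_delta, of k m' f m x] by (simp add: tgt_def)

lemma src_act:
  assumes "x \<in> simplices Z m" "f \<in> delta m' m" "k \<le> m'" "compose {..k} f (src_map k) = src_map k"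
  shows "src Z m' k (act Z m' m f x) = src Z m k x"
  using assms act_compose[OF src_map_in_delta, of k m' f m x] by (simp add: src_def)

lemma simplicial_set_dist_sset:
  "simplicial_set (dist_sset Z :: ('a \<Rightarrow> 'r::comm_semiring_1) sset)"
proof
  fix m n f and p :: "'a \<Rightarrow> 'r"
  assume "f \<in> delta m n" "p \<in> simplices (dist_sset Z) n"
  then show "act (dist_sset Z) m n f p \<in> simplices (dist_sset Z) m"
    by (auto simp: dist_sset_def intro: dist_map_in_dist act_closed)
next
  fix n and p :: "'a \<Rightarrow> 'r"
  assume "p \<in> simplices (dist_sset Z) n"
  then show "act (dist_sset Z) n n (\<lambda>i\<in>{..n}. i) p = p"
    by (auto simp: dist_sset_def intro: dist_map_ident act_id)
next
  fix l m n f g and p :: "'a \<Rightarrow> 'r"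
  assume fg: "f \<in> delta l m" "g \<in> delta m n" and "p \<in> simplices (dist_sset Z) n"
  then have p: "p \<in> dist (simplices Z n)"
    by (simp add: dist_sset_def)
  \<comment> \<open>A distribution vanishes off the \<open>n\<close>-simplices, so functoriality of
    \<open>act\<close> on genuine simplices is enough.\<close>
  have "dist_map (act Z l n (compose {..l} g f)) p =
      dist_map (\<lambda>s. act Z l m f (act Z m n g s)) p"
    using p act_compose[OF fg] by (rule dist_map_cong)
  then show "act (dist_sset Z) l n (compose {..l} g f) p =
      act (dist_sset Z) l m f (act (dist_sset Z) m n g p)"
    by (simp add: dist_sset_def dist_map_compose[OF finite_dist[OF p]])
qed

end


section \<open>Simplicial sets with unique gluing\<close>

text \<open>A Segal-type condition: the simplices of dimension \<open>m + n - k\<close> are the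
  fibre product of those of dimensions \<open>m\<close> and \<open>n\<close> over those of dimension
  \<open>k\<close>. Beyond the simplicial structure, this is all that the composition uses of the
  nerve.\<close>

locale gluing_sset = simplicial_set Y for Y :: "'a sset" +
  assumes glue: "\<lbrakk>k \<le> m; k \<le> n; x \<in> simplices Y m; y \<in> simplices Y n; tgt Y m k x = src Y n k y\<rbrakk>
    \<Longrightarrow> \<exists>!z. z \<in> simplices Y (m + n - k) \<and> src Y (m + n - k) m z = x \<and> tgt Y (m + n - k) n z = y"
begin

text \<open>By \<open>tgt_src\<close> the two faces of \<open>z\<close> agree on the overlap, so
  uniqueness in \<open>glue\<close> applies to them.\<close>

lemma glue_unique:
  assumes "k \<le> m" "k \<le> n" "j = m + n - k" "z \<in> simplices Y j" "z' \<in> simplices Y j"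
    "src Y j m z = src Y j m z'" "tgt Y j n z = tgt Y j n z'"
  shows "z = z'"
proof -
  have "tgt Y m k (src Y j m z) = src Y n k (tgt Y j n z)"
    using assms by (intro tgt_src)
  moreover have "src Y j m z \<in> simplices Y m" "tgt Y j n z \<in> simplices Y n"
    using assms by (auto intro!: src_closed tgt_closed)
  ultimately show ?thesis
    using glue[of k m n "src Y j m z" "tgt Y j n z"] assms by metis
qed

text \<open>
  The denominator may vanish, and \<open>sf_inverse 0\<close> is unspecified; this is harmless, since
  for composable \<open>p\<close> and \<open>q\<close> both other factors are then zero.
\<close>

definition dist_comp ::
    "nat \<Rightarrow> nat \<Rightarrow> nat \<Rightarrow> ('a \<Rightarrow> 'r) \<Rightarrow> ('a \<Rightarrow> 'r) \<Rightarrow> 'a \<Rightarrow> 'r::zero_sum_free_semifield" where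
  "dist_comp m n k p q = (\<lambda>z.
     if z \<in> simplices Y (m + n - k)
     then p (src Y (m + n - k) m z) * q (tgt Y (m + n - k) n z) *
       sf_inverse (dist_map (tgt Y m k) p (tgt Y m k (src Y (m + n - k) m z)))
     else 0)"

abbreviation DY :: "('a \<Rightarrow> 'r::zero_sum_free_semifield) sset" where
  "DY \<equiv> dist_sset Y"

sublocale D: simplicial_set DY
  by (rule simplicial_set_dist_sset)

lemma simplices_DY: "simplices DY n = dist (simplices Y n)"
  by (simp add: dist_sset_def)

lemma act_DY: "act DY m n f = dist_map (act Y m n f)"
  by (simp add: dist_sset_def)

lemma src_DY: "src DY n k = dist_map (src Y n k)"
  by (simp add: src_def[abs_def] act_DY)

lemma tgt_DY: "tgt DY n k = dist_map (tgt Y n k)"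
  by (simp add: tgt_def[abs_def] act_DY)

text \<open>The denominator is written as a marginal of \<open>p\<close>; for a composable pair it
  is also that of \<open>q\<close>, so the formula is symmetric in the two factors.\<close>

lemma dist_comp_apply:
  assumes "z \<in> simplices Y j" "j = m + n - k"
  shows "dist_comp m n k p q z = p (src Y j m z) * q (tgt Y j n z) *
    sf_inverse (tgt DY m k p (tgt Y m k (src Y j m z)))"
  using assms by (simp add: dist_comp_def tgt_DY)

text \<open>A glueing is determined by its two faces, so the set embeds into
  \<open>A \<times> B\<close>. This gives composites finite support.\<close>

lemma finite_dist_comp:
  assumes "k \<le> m" "k \<le> n" "j = m + n - k" "finite A" "finite B"
  shows "finite {z \<in> simplices Y j. src Y j m z \<in> A \<and> tgt Y j n z \<in> B}"
proof (rule inj_on_finite)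
  show "inj_on (\<lambda>z. (src Y j m z, tgt Y j n z))
      {z \<in> simplices Y j. src Y j m z \<in> A \<and> tgt Y j n z \<in> B}"
    using glue_unique[OF assms(1-3)] by (auto intro!: inj_onI)
  show "(\<lambda>z. (src Y j m z, tgt Y j n z)) ` {z \<in> simplices Y j. src Y j m z \<in> A \<and> tgt Y j n z \<in> B}
      \<subseteq> A \<times> B"
    by auto
qed (use assms in auto)

section \<open>Naturality of the conditional product\<close>

text \<open>At \<open>w\<close> with faces \<open>x'\<close> and \<open>y'\<close>, the right side
  sums over the glueings \<open>z\<close> that restrict to \<open>w\<close> along \<open>h\<close>.
  They correspond to pairs of an \<open>x\<close> over \<open>x'\<close> and a \<open>y\<close> over
  \<open>y'\<close>, so the sum factors. Composites are treated as mere functions of finite support;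
  \<open>dist_comp_closed\<close> is derived from this lemma later.\<close>

lemma dist_comp_naturality:
  fixes p q :: "'a \<Rightarrow> 'r::zero_sum_free_semifield"
  assumes "composable DY m n k p q" "k \<le> m'" "k \<le> n'"
    and f: "f \<in> delta m' m" and g: "g \<in> delta n' n"
    and fk: "compose {..k} f (tgt_map m' k) = tgt_map m k"
    and gk: "compose {..k} g (src_map k) = src_map k"
    and j: "j = m + n - k" and j': "j' = m' + n' - k"
    and h: "h \<in> delta j' j"
    and hf: "compose {..m'} h (src_map m') = compose {..m'} (src_map m) f"
    and hg: "compose {..n'} h (tgt_map j' n') = compose {..n'} (tgt_map j n) g"
  shows "dist_comp m' n' k (act DY m' m f p) (act DY n' n g q) =
    act DY j' j h (dist_comp m n k p q)"
proof
  fix w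
  have k: "k \<le> m" "k \<le> n" and p: "p \<in> dist (simplices Y m)" and q: "q \<in> dist (simplices Y n)"
    using assms by (auto simp: composable_def simplices_DY)
  let ?A = "{x. p x \<noteq> 0}" and ?B = "{y. q y \<noteq> 0}"
  let ?S = "src Y j m" and ?T = "tgt Y j n"
  let ?r = "tgt DY m k p"
  let ?E = "{z \<in> simplices Y j. ?S z \<in> ?A \<and> ?T z \<in> ?B}"
  have finA: "finite ?A" and finB: "finite ?B"
    using p q by (auto intro: finite_dist)
  have finE: "finite ?E"
    using finite_dist_comp[OF k j finA finB] .
  have suppE: "{z. dist_comp m n k p q z \<noteq> 0} \<subseteq> ?E"
    using j by (auto simp: dist_comp_def split: if_splits)
  have mn: "m \<le> j" "n \<le> j" "m' \<le> j'" "n' \<le> j'"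
    using k assms(2,3) j j' by auto
  \<comment> \<open>The gluing equations say that \<open>h\<close> restricts to \<open>f\<close> on
    the initial \<open>[m']\<close> and to \<open>g\<close> on the final \<open>[n']\<close>, so the
    faces of a restricted glueing are the restricted faces.\<close>
  have Sh: "src Y j' m' (act Y j' j h z) = act Y m' m f (?S z)" if "z \<in> simplices Y j" for z
    unfolding src_def using that f h hf mn by (intro act_square src_map_in_delta) auto
  have Th: "tgt Y j' n' (act Y j' j h z) = act Y n' n g (?T z)" if "z \<in> simplices Y j" for z
    unfolding tgt_def using that g h hg mn by (intro act_square tgt_map_in_delta) auto
  have rhs: "act DY j' j h (dist_comp m n k p q) w =
      (\<Sum>z | z \<in> ?E \<and> act Y j' j h z = w. dist_comp m n k p q z)"
    unfolding act_DY by (rule dist_map_eq_sum[OF finE suppE])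
  show "dist_comp m' n' k (act DY m' m f p) (act DY n' n g q) w =
    act DY j' j h (dist_comp m n k p q) w"
  proof (cases "w \<in> simplices Y j'")
    \<comment> \<open>The left side is zero by definition, and no simplex restricts to
      \<open>w\<close>.\<close>
    case False
    then have "{z. z \<in> ?E \<and> act Y j' j h z = w} = {}"
      using act_closed[OF h] by auto
    then show ?thesis
      unfolding rhs using False j' by (simp add: dist_comp_def del: Collect_empty_eq)
  next
    case w: True
    define x' y' where "x' = src Y j' m' w" and "y' = tgt Y j' n' w"
    define c where "c = tgt Y m' k x'"
    have c: "c = src Y n' k y'"
      unfolding c_def x'_def y'_def using assms(2,3) j' w by (rule tgt_src)
    \<comment> \<open>\<open>f\<close> fixes the overlap, so both composites have the same
      denominator function.\<close>
    have r: "tgt DY m' k (act DY m' m f p) = ?r"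
      using p f assms(2) fk by (intro D.tgt_act) (auto simp: simplices_DY)
    \<comment> \<open>Everything over \<open>x'\<close> or \<open>y'\<close> has the overlap
      \<open>c\<close> of \<open>w\<close>. So all such pairs glue, and the denominator is constant
      on them.\<close>
    have xc: "tgt Y m k x = c" if "x \<in> simplices Y m" "act Y m' m f x = x'" for x
      using tgt_act[OF that(1) f assms(2) fk] that(2) by (simp add: c_def)
    have yc: "src Y n k y = c" if "y \<in> simplices Y n" "act Y n' n g y = y'" for y
      using src_act[OF that(1) g assms(3) gk] that(2) by (simp add: c)
    let ?P = "{x. x \<in> ?A \<and> act Y m' m f x = x'}" and ?Q = "{y. y \<in> ?B \<and> act Y n' n g y = y'}"
    let ?F = "{z. z \<in> ?E \<and> act Y j' j h z = w}"
    \<comment> \<open>Injectivity is uniqueness of glueings in dimension \<open>j\<close>. For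
      surjectivity, a pair glues to some \<open>z\<close>, and uniqueness in dimension
      \<open>j'\<close> identifies its restriction along \<open>h\<close> with
      \<open>w\<close>.\<close>
    have bij: "bij_betw (\<lambda>z. (?S z, ?T z)) ?F (?P \<times> ?Q)"
    proof (rule bij_betwI')
      fix z z' assume "z \<in> ?F" "z' \<in> ?F"
      then show "((?S z, ?T z) = (?S z', ?T z')) = (z = z')"
        using glue_unique[OF k j] by auto
    next
      fix z assume "z \<in> ?F"
      then show "(?S z, ?T z) \<in> ?P \<times> ?Q"
        using Sh Th by (auto simp: x'_def y'_def)
    next
      fix xy assume "xy \<in> ?P \<times> ?Q"
      then obtain x y where xy: "xy = (x, y)" "x \<in> ?P" "y \<in> ?Q"
        by auto
      then have X: "x \<in> simplices Y m" "y \<in> simplices Y n"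
        using p q by (auto dest: dist_nonzeroD)
      then have "tgt Y m k x = src Y n k y"
        using xy xc yc by auto
      then obtain z where z: "z \<in> simplices Y j" "?S z = x" "?T z = y"
        using glue[OF k X] j by auto
      have "act Y j' j h z = w"
        using assms(2,3) j'
      proof (rule glue_unique)
        show "act Y j' j h z \<in> simplices Y j'"
          using z h by (intro act_closed)
        show "src Y j' m' (act Y j' j h z) = src Y j' m' w"
          "tgt Y j' n' (act Y j' j h z) = tgt Y j' n' w"
          using z xy Sh Th by (auto simp: x'_def y'_def)
      qed (rule w)
      then show "\<exists>z\<in>?F. xy = (?S z, ?T z)"
        using z xy by auto
    qed
    have "act DY j' j h (dist_comp m n k p q) w =
        (\<Sum>z\<in>?F. p (?S z) * q (?T z) * sf_inverse (?r c))"
      unfolding rhs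
    proof (rule sum.cong)
      fix z assume z: "z \<in> ?F"
      then have "tgt Y m k (?S z) = c"
        using Sh mn by (intro xc src_closed) (auto simp: x'_def)
      then show "dist_comp m n k p q z = p (?S z) * q (?T z) * sf_inverse (?r c)"
        using z by (subst dist_comp_apply[of _ j]) (auto simp: j)
    qed simp
    also have "\<dots> = (\<Sum>(x, y)\<in>?P \<times> ?Q. p x * q y * sf_inverse (?r c))"
      using sum.reindex_bij_betw[OF bij, of "\<lambda>(x, y). p x * q y * sf_inverse (?r c)"] by simp
    also have "\<dots> = (\<Sum>(x, y)\<in>?P \<times> ?Q. p x * q y) * sf_inverse (?r c)"
      by (simp add: sum_distrib_right case_prod_beta)
    \<comment> \<open>By distributivity the sum over pairs is the product of the two fibre sums,
      which are the pushforwards of \<open>p\<close> at \<open>x'\<close> and of \<open>q\<close> at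
      \<open>y'\<close>.\<close>
    also have "\<dots> = sum p ?P * sum q ?Q * sf_inverse (?r c)"
      by (simp add: sum_product sum.cartesian_product)
    also have "\<dots> = dist_comp m' n' k (act DY m' m f p) (act DY n' n g q) w"
      by (subst dist_comp_apply[OF w j'])
        (simp add: r flip: x'_def y'_def c_def, simp add: act_DY dist_map_def)
    finally show ?thesis ..
  qed
qed

section \<open>Identity laws\<close>

text \<open>Here \<open>q\<close> is itself the marginal of \<open>p\<close> on the overlap and
  cancels against the denominator; where it is zero, \<open>p\<close> is zero too.\<close>

lemma dist_comp_identity_right:
  fixes p q :: "'a \<Rightarrow> 'r::zero_sum_free_semifield"
  assumes "composable DY m n n p q"
  shows "dist_comp m n n p q = p"
proof
  fix z
  have p: "p \<in> dist (simplices Y m)" and "q \<in> simplices DY n" and "n \<le> m"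
    and r: "tgt DY m n p = src DY n n q"
    using assms by (auto simp: composable_def simplices_DY)
  then have q: "tgt DY m n p = q"
    using D.src_self by metis
  show "dist_comp m n n p q z = p z"
  proof (cases "z \<in> simplices Y m")
    case True
    have "p z = 0" if "q (tgt Y m n z) = 0"
      using p that unfolding q[symmetric] tgt_DY by (rule dist_map_eq_0D)
    then show ?thesis
      using True mult_sf_inverse[of "q (tgt Y m n z)"]
      by (cases "q (tgt Y m n z) = 0") (auto simp: dist_comp_apply[of _ m] src_self q mult.assoc)
  next
    case False
    then show ?thesis
      using p by (auto simp: dist_comp_def dest: dist_nonzeroD)
  qed
qed

lemma dist_comp_identity_left:
  fixes p q :: "'a \<Rightarrow> 'r::zero_sum_free_semifield"
  assumes "composable DY m n m p q"
  shows "dist_comp m n m p q = q"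
proof
  fix z
  have q: "q \<in> dist (simplices Y n)" and "p \<in> simplices DY m" and "m \<le> n"
    and r: "tgt DY m m p = src DY n m q"
    using assms by (auto simp: composable_def simplices_DY)
  then have p: "src DY n m q = p"
    using D.tgt_self by metis
  show "dist_comp m n m p q z = q z"
  proof (cases "z \<in> simplices Y n")
    case True
    have "q z = 0" if "p (src Y n m z) = 0"
      using q that unfolding p[symmetric] src_DY by (rule dist_map_eq_0D)
    moreover have "src Y n m z \<in> simplices Y m"
      using True \<open>m \<le> n\<close> by (rule src_closed)
    ultimately show ?thesis
      using True mult_sf_inverse[of "p (src Y n m z)"]
      by (cases "p (src Y n m z) = 0")
        (auto simp: dist_comp_apply[of _ n] tgt_self r p mult.assoc mult.left_commute[of "p _"])
  next
    case False
    then show ?thesis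
      using q by (auto simp: dist_comp_def dest: dist_nonzeroD)
  qed
qed

section \<open>Faces of composites and closure\<close>

lemma composable_src:
  assumes "composable DY m n k p q" "k \<le> l" "l \<le> n"
  shows "composable DY m l k p (src DY n l q)"
  using assms by (auto simp: composable_def D.src_src intro: D.src_closed)

lemma composable_tgt:
  assumes "composable DY m n k p q" "k \<le> l" "l \<le> m"
  shows "composable DY l n k (tgt DY m l p) q"
  using assms by (auto simp: composable_def D.tgt_tgt intro: D.tgt_closed)

text \<open>This is naturality for the identity on the first factor, written
  \<open>src_map m\<close>, and \<open>src_map l\<close> on the second; the glued map is again an
  initial inclusion.\<close>

lemma src_dist_comp:
  assumes "composable DY m n k p q" "k \<le> l" "l \<le> n"
  shows "src DY (m + n - k) (m + l - k) (dist_comp m n k p q) = dist_comp m l k p (src DY n l q)"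
proof -
  have k: "k \<le> m" and p: "src DY m m p = p"
    using assms by (auto simp: composable_def intro: D.src_self)
  have "dist_comp m l k (act DY m m (src_map m) p) (act DY l n (src_map l) q) =
      act DY (m + l - k) (m + n - k) (src_map (m + l - k)) (dist_comp m n k p q)"
    using assms(1) k assms(2) _ _ _ _ refl refl
    by (rule dist_comp_naturality)
      (use assms k in \<open>auto simp: src_map_in_delta compose_src_src,
        auto simp: src_map_def tgt_map_def compose_def fun_eq_iff\<close>)
  then show ?thesis
    using p by (simp add: src_def)
qed

lemma tgt_dist_comp:
  assumes "composable DY m n k p q" "k \<le> l" "l \<le> m"
  shows "tgt DY (m + n - k) (l + n - k) (dist_comp m n k p q) = dist_comp l n k (tgt DY m l p) q"
proof -
  have k: "k \<le> n" and q: "src DY n n q = q"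
    using assms by (auto simp: composable_def intro: D.src_self)
  have "dist_comp l n k (act DY l m (tgt_map m l) p) (act DY n n (src_map n) q) =
      act DY (l + n - k) (m + n - k) (tgt_map (m + n - k) (l + n - k)) (dist_comp m n k p q)"
    using assms(1) assms(2) k _ _ _ _ refl refl
    by (rule dist_comp_naturality)
      (use assms k in \<open>auto simp: src_map_in_delta tgt_map_in_delta compose_src_src compose_tgt_tgt,
        auto simp: src_map_def tgt_map_def compose_def fun_eq_iff\<close>)
  then show ?thesis
    using q by (simp add: src_def tgt_def)
qed

text \<open>Cutting \<open>q\<close> down to the overlap, the case \<open>l = k\<close> of
  \<open>src_dist_comp\<close>, leaves a composite that the identity law reduces to
  \<open>p\<close>.\<close>

lemma src_dist_comp_eq:
  assumes "composable DY m n k p q"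
  shows "src DY (m + n - k) m (dist_comp m n k p q) = p"
proof -
  have "k \<le> n"
    using assms by (simp add: composable_def)
  then show ?thesis
    using src_dist_comp[OF assms, of k] dist_comp_identity_right composable_src[OF assms, of k]
    by simp
qed

lemma tgt_dist_comp_eq:
  assumes "composable DY m n k p q"
  shows "tgt DY (m + n - k) n (dist_comp m n k p q) = q"
proof -
  have "k \<le> m"
    using assms by (simp add: composable_def)
  then show ?thesis
    using tgt_dist_comp[OF assms, of k] dist_comp_identity_left composable_tgt[OF assms, of k]
    by simp
qed

lemma dist_comp_closed:
  assumes "composable DY m n k p q"
  shows "dist_comp m n k p q \<in> simplices DY (m + n - k)"
proof -
  let ?c = "dist_comp m n k p q"
  have k: "k \<le> m" "k \<le> n" and p: "p \<in> dist (simplices Y m)" and q: "q \<in> dist (simplices Y n)"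
    using assms by (auto simp: composable_def simplices_DY)
  have "{z. ?c z \<noteq> 0} \<subseteq> {z \<in> simplices Y (m + n - k). src Y (m + n - k) m z \<in> {x. p x \<noteq> 0} \<and>
      tgt Y (m + n - k) n z \<in> {y. q y \<noteq> 0}}"
    by (auto simp: dist_comp_def split: if_splits)
  then have fin: "finite {z. ?c z \<noteq> 0}"
    using finite_dist_comp[OF k refl finite_dist[OF p] finite_dist[OF q]] by (rule finite_subset)
  \<comment> \<open>Pushforward preserves mass, and pushing the composite forward to its initial
    face gives back \<open>p\<close>.\<close>
  have "(\<Sum>z | ?c z \<noteq> 0. ?c z) = (\<Sum>x | p x \<noteq> 0. p x)"
    using sum_dist_map[OF fin, of "src Y (m + n - k) m"] src_dist_comp_eq[OF assms]
    by (simp add: src_DY)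
  then show ?thesis
    using fin p by (auto simp: simplices_DY dist_def dist_comp_def split: if_splits)
qed

section \<open>Back-and-forth\<close>

text \<open>The face of \<open>z\<close> is \<open>p\<close> composed with an initial marginal of
  \<open>q\<close>. Composing it with all of \<open>q\<close> divides by that same marginal, which
  cancels.\<close>

lemma dist_comp_back_and_forth_src:
  fixes p q :: "'a \<Rightarrow> 'r::zero_sum_free_semifield"
  assumes pq: "composable DY m n k p q" and j: "j = m + n - k" and z: "z = dist_comp m n k p q"
    and m': "m \<le> m'" "m' \<le> j"
  shows "composable DY m' n (m' + n - j) (src DY j m' z) q"
    and "dist_comp m' n (m' + n - j) (src DY j m' z) q = z"
proof -
  define l where "l = m' + n - j"
  have k: "k \<le> m" "k \<le> n" and q: "q \<in> dist (simplices Y n)"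
    using pq by (auto simp: composable_def simplices_DY)
  \<comment> \<open>Since \<open>l - k = m' - m\<close>, the \<open>m'\<close>-face of
    \<open>z\<close> is the composite of \<open>p\<close> with the initial \<open>l\<close>-face of
    \<open>q\<close>, and it overlaps \<open>q\<close> in \<open>[l]\<close>.\<close>
  have l: "k \<le> l" "l \<le> n" "l \<le> m'" "m' = m + l - k" "j = m' + n - l"
    using j k m' by (auto simp: l_def)
  have zj: "z \<in> simplices DY j"
    unfolding z j using pq by (rule dist_comp_closed)
  have Sz: "src DY j m' z = dist_comp m l k p (src DY n l q)"
    unfolding z j l(4) using pq l(1,2) by (rule src_dist_comp)
  have Tz: "tgt DY m' l (src DY j m' z) = src DY n l q"
    using D.tgt_src[OF l(3,2,5) zj] tgt_dist_comp_eq[OF pq] by (simp add: z j)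
  show "composable DY m' n (m' + n - j) (src DY j m' z) q"
    unfolding l_def[symmetric] composable_def
    using l m' q Tz D.src_closed[OF zj] by (simp add: simplices_DY)
  show "dist_comp m' n (m' + n - j) (src DY j m' z) q = z"
    unfolding l_def[symmetric]
  proof
    fix w
    show "dist_comp m' n l (src DY j m' z) q w = z w"
    proof (cases "w \<in> simplices Y j")
      case False
      then show ?thesis
        using l(5) j by (simp add: dist_comp_def z)
    next
      case w: True
      let ?u = "src Y j m' w"
      let ?v = "tgt Y m' l ?u"
      let ?x = "src Y j m w"
      let ?i = "sf_inverse (tgt DY m k p (tgt Y m k ?x))"
      have v: "?v = src Y n l (tgt Y j n w)"
        using l(3,2,5) w by (rule tgt_src)
      have u: "src Y m' m ?u = ?x" "?u \<in> simplices Y m'"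
        using w m' by (auto intro: src_src src_closed)
      have "dist_comp m' n l (src DY j m' z) q w =
          p ?x * src DY n l q ?v * ?i * q (tgt Y j n w) * sf_inverse (src DY n l q ?v)"
        by (subst dist_comp_apply[OF w l(5)], subst Tz, subst Sz,
          subst dist_comp_apply[OF u(2) l(4)]) (simp add: u(1))
      also have "\<dots> = p ?x * q (tgt Y j n w) * ?i"
      proof (cases "src DY n l q ?v = 0")
        \<comment> \<open>If the marginal of \<open>q\<close> is zero at \<open>?v\<close>, then
          \<open>q\<close> is zero at the point above it, and both sides vanish.\<close>
        case True
        then have "q (tgt Y j n w) = 0"
          unfolding v src_DY by (rule dist_map_eq_0D[OF q])
        then show ?thesis
          by simp
      next
        case False
        have "p ?x * src DY n l q ?v * ?i * q (tgt Y j n w) * sf_inverse (src DY n l q ?v) =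
            p ?x * q (tgt Y j n w) * ?i * (src DY n l q ?v * sf_inverse (src DY n l q ?v))"
          by (simp only: mult_ac)
        then show ?thesis
          by (simp add: mult_sf_inverse[OF False])
      qed
      also have "\<dots> = z w"
        unfolding z by (rule dist_comp_apply[OF w j, symmetric])
      finally show ?thesis .
    qed
  qed
qed

text \<open>The mirror image: the face of \<open>z\<close> is a final marginal of \<open>p\<close>
  composed with \<open>q\<close>, and that marginal cancels against the new denominator.\<close>

lemma dist_comp_back_and_forth_tgt:
  fixes p q :: "'a \<Rightarrow> 'r::zero_sum_free_semifield"
  assumes pq: "composable DY m n k p q" and j: "j = m + n - k" and z: "z = dist_comp m n k p q"
    and n': "n \<le> n'" "n' \<le> j"
  shows "composable DY m n' (m + n' - j) p (tgt DY j n' z)"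
    and "dist_comp m n' (m + n' - j) p (tgt DY j n' z) = z"
proof -
  define l where "l = m + n' - j"
  have k: "k \<le> m" "k \<le> n" and p: "p \<in> dist (simplices Y m)"
    using pq by (auto simp: composable_def simplices_DY)
  have l: "k \<le> l" "l \<le> m" "l \<le> n'" "n' = l + n - k" "j = m + n' - l"
    using j k n' by (auto simp: l_def)
  have zj: "z \<in> simplices DY j"
    unfolding z j using pq by (rule dist_comp_closed)
  have Tz: "tgt DY j n' z = dist_comp l n k (tgt DY m l p) q"
    unfolding z j l(4) using pq l(1,2) by (rule tgt_dist_comp)
  have Sz: "tgt DY m l p = src DY n' l (tgt DY j n' z)"
    using D.tgt_src[OF l(2,3,5) zj] src_dist_comp_eq[OF pq] by (simp add: z j)
  show "composable DY m n' (m + n' - j) p (tgt DY j n' z)"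
    unfolding l_def[symmetric] composable_def
    using l n' p Sz D.tgt_closed[OF zj] by (simp add: simplices_DY)
  \<comment> \<open>The inner composite starts from a marginal of \<open>p\<close>, yet its
    denominator is still the marginal of \<open>p\<close> on \<open>[k]\<close>.\<close>
  have r: "tgt DY l k (tgt DY m l p) = tgt DY m k p"
    using p l by (intro D.tgt_tgt) (auto simp: simplices_DY)
  show "dist_comp m n' (m + n' - j) p (tgt DY j n' z) = z"
    unfolding l_def[symmetric]
  proof
    fix w
    show "dist_comp m n' l p (tgt DY j n' z) w = z w"
    proof (cases "w \<in> simplices Y j")
      case False
      then show ?thesis
        using l(5) j by (simp add: dist_comp_def z)
    next
      case w: True
      let ?x = "src Y j m w" and ?y = "tgt Y j n w"
      let ?v = "tgt Y m l ?x"
      let ?i = "sf_inverse (tgt DY m k p (tgt Y m k ?x))"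
      have v: "src Y n' l (tgt Y j n' w) = ?v"
        using tgt_src[OF l(2,3,5) w] by simp
      have u: "tgt Y n' n (tgt Y j n' w) = ?y" "tgt Y j n' w \<in> simplices Y n'"
        using w n' by (auto intro: tgt_tgt tgt_closed)
      have x: "tgt Y l k ?v = tgt Y m k ?x"
        using w l k by (intro tgt_tgt src_closed) auto
      have "dist_comp m n' l p (tgt DY j n' z) w =
          p ?x * (tgt DY m l p ?v * q ?y * ?i) * sf_inverse (tgt DY m l p ?v)"
        by (subst dist_comp_apply[OF w l(5)], subst Tz,
          subst dist_comp_apply[OF u(2) l(4)]) (simp add: u(1) v r x)
      also have "\<dots> = p ?x * q ?y * ?i"
      proof (cases "tgt DY m l p ?v = 0")
        case True
        then have "p ?x = 0"
          unfolding tgt_DY by (rule dist_map_eq_0D[OF p])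
        then show ?thesis
          by simp
      next
        case False
        have "p ?x * (tgt DY m l p ?v * q ?y * ?i) * sf_inverse (tgt DY m l p ?v) =
            p ?x * q ?y * ?i * (tgt DY m l p ?v * sf_inverse (tgt DY m l p ?v))"
          by (simp only: mult_ac)
        then show ?thesis
          by (simp add: mult_sf_inverse[OF False])
      qed
      also have "\<dots> = z w"
        unfolding z by (rule dist_comp_apply[OF w j, symmetric])
      finally show ?thesis .
    qed
  qed
qed

lemma compository_dist_sset:
  "compository (DY :: ('a \<Rightarrow> 'r::zero_sum_free_semifield) sset) dist_comp"
proof (intro compository.intro compository_axioms.intro D.simplicial_set_axioms)
  fix m n k m' n' f g h and p q :: "'a \<Rightarrow> 'r"
  assume *: "composable DY m n k p q" "k \<le> m'" "k \<le> n'" "f \<in> delta m' m" "g \<in> delta n' n"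
    "compose {..k} f (tgt_map m' k) = tgt_map m k" "compose {..k} g (src_map k) = src_map k"
    "h \<in> delta (m' + n' - k) (m + n - k)"
    "compose {..m'} h (src_map m') = compose {..m'} (src_map m) f"
    "compose {..n'} h (tgt_map (m' + n' - k) n') = compose {..n'} (tgt_map (m + n - k) n) g"
  \<comment> \<open>The restricted pair is composable because \<open>f\<close> and \<open>g\<close>
    leave the overlap marginals unchanged.\<close>
  then show "composable DY m' n' k (act DY m' m f p) (act DY n' n g q) \<and>
      dist_comp m' n' k (act DY m' m f p) (act DY n' n g q) =
        act DY (m' + n' - k) (m + n - k) h (dist_comp m n k p q)"
    by (auto simp: composable_def D.tgt_act D.src_act intro: D.act_closed dist_comp_naturality)
qed (auto intro: dist_comp_closed dist_comp_identity_right dist_comp_identity_left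
  dist_comp_back_and_forth_src dist_comp_back_and_forth_tgt)

end

section \<open>The nerve of a category\<close>

lemma simplices_nerve_iff:
  "(F, G) \<in> simplices (nerve C) n \<longleftrightarrow>
    F \<in> {..n} \<rightarrow>\<^sub>E Obj C \<and> G \<in> {(i, j). i \<le> j \<and> j \<le> n} \<rightarrow>\<^sub>E Mor C \<and>
    (\<forall>i j. i \<le> j \<longrightarrow> j \<le> n \<longrightarrow> Dom C (G (i, j)) = F i \<and> Cod C (G (i, j)) = F j) \<and>
    (\<forall>i\<le>n. G (i, i) = Ident C (F i)) \<and>
    (\<forall>i j l. i \<le> j \<longrightarrow> j \<le> l \<longrightarrow> l \<le> n \<longrightarrow> G (i, l) = Comp C (G (j, l)) (G (i, j)))"
proof -
  have all_Mor: "(\<forall>f\<in>{(i, j). i \<le> j \<and> j \<le> n}. P f) \<longleftrightarrow>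
      (\<forall>i j. i \<le> j \<longrightarrow> j \<le> n \<longrightarrow> P (i, j))" for P :: "nat \<times> nat \<Rightarrow> bool"
    by auto
  \<comment> \<open>Composable pairs of arrows in \<open>[n]\<close> are chains
    \<open>i \<le> j \<le> l\<close>; the bound \<open>j \<le> n\<close> follows from
    \<open>l \<le> n\<close>.\<close>
  have "(\<forall>i j. i \<le> j \<longrightarrow> j \<le> n \<longrightarrow> (\<forall>l. j \<le> l \<longrightarrow> l \<le> n \<longrightarrow>
        G (i, l) = Comp C (G (j, l)) (G (i, j)))) \<longleftrightarrow>
      (\<forall>i j l. i \<le> j \<longrightarrow> j \<le> l \<longrightarrow> l \<le> n \<longrightarrow> G (i, l) = Comp C (G (j, l)) (G (i, j)))"
    (is "?L \<longleftrightarrow> ?R")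
  proof
    assume L: ?L
    show ?R
    proof (intro allI impI)
      fix i j l assume ijl: "i \<le> j" "j \<le> l" "l \<le> n"
      then have "j \<le> n"
        by simp
      with L ijl show "G (i, l) = Comp C (G (j, l)) (G (i, j))"
        by blast
    qed
  qed blast
  then show ?thesis
    unfolding nerve_def functors_def ord_cat_def by (simp add: all_Mor Ball_def[of "{..n}"] imp_conjL)
qed

lemma
  assumes "(F, G) \<in> simplices (nerve C) n"
  shows nerve_PiE: "F \<in> {..n} \<rightarrow>\<^sub>E Obj C" "G \<in> {(i, j). i \<le> j \<and> j \<le> n} \<rightarrow>\<^sub>E Mor C"
    and nerve_Obj: "i \<le> n \<Longrightarrow> F i \<in> Obj C"
    and nerve_Mor: "i \<le> j \<Longrightarrow> j \<le> n \<Longrightarrow> G (i, j) \<in> Mor C"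
    and nerve_Dom: "i \<le> j \<Longrightarrow> j \<le> n \<Longrightarrow> Dom C (G (i, j)) = F i"
    and nerve_Cod: "i \<le> j \<Longrightarrow> j \<le> n \<Longrightarrow> Cod C (G (i, j)) = F j"
    and nerve_Ident: "i \<le> n \<Longrightarrow> G (i, i) = Ident C (F i)"
    and nerve_Comp: "i \<le> j \<Longrightarrow> j \<le> l \<Longrightarrow> l \<le> n \<Longrightarrow> G (i, l) = Comp C (G (j, l)) (G (i, j))"
proof -
  have PiE: "F \<in> {..n} \<rightarrow>\<^sub>E Obj C" "G \<in> {(i, j). i \<le> j \<and> j \<le> n} \<rightarrow>\<^sub>E Mor C"
    and Dom_Cod: "\<forall>i j. i \<le> j \<longrightarrow> j \<le> n \<longrightarrow> Dom C (G (i, j)) = F i \<and> Cod C (G (i, j)) = F j"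
    and Id: "\<forall>i\<le>n. G (i, i) = Ident C (F i)"
    and Comp: "\<forall>i j l. i \<le> j \<longrightarrow> j \<le> l \<longrightarrow> l \<le> n \<longrightarrow>
      G (i, l) = Comp C (G (j, l)) (G (i, j))"
    using assms[unfolded simplices_nerve_iff] by - (elim conjE, assumption)+
  show "F \<in> {..n} \<rightarrow>\<^sub>E Obj C" "G \<in> {(i, j). i \<le> j \<and> j \<le> n} \<rightarrow>\<^sub>E Mor C"
    by (fact PiE)+
  show "i \<le> n \<Longrightarrow> F i \<in> Obj C" "i \<le> j \<Longrightarrow> j \<le> n \<Longrightarrow> G (i, j) \<in> Mor C"
    using PiE by auto
  show "i \<le> j \<Longrightarrow> j \<le> n \<Longrightarrow> Dom C (G (i, j)) = F i"
    "i \<le> j \<Longrightarrow> j \<le> n \<Longrightarrow> Cod C (G (i, j)) = F j"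
    using Dom_Cod by auto
  show "i \<le> n \<Longrightarrow> G (i, i) = Ident C (F i)"
    using Id by auto
  show "i \<le> j \<Longrightarrow> j \<le> l \<Longrightarrow> l \<le> n \<Longrightarrow> G (i, l) = Comp C (G (j, l)) (G (i, j))"
    using Comp[rule_format] .
qed

lemma act_nerve:
  "act (nerve C) m n f (F, G) =
    (\<lambda>i\<in>{..m}. F (f i), \<lambda>(i, j)\<in>{(i, j). i \<le> j \<and> j \<le> m}. G (f i, f j))"
  by (auto simp: nerve_def ord_cat_def compose_def restrict_def fun_eq_iff)

text \<open>Both components are extensional, so their values off the domain agree
  automatically.\<close>

lemma nerve_eqI:
  assumes "(F, G) \<in> simplices (nerve C) n" "(F', G') \<in> simplices (nerve C) n"
    "\<And>i. i \<le> n \<Longrightarrow> F i = F' i" "\<And>i j. i \<le> j \<Longrightarrow> j \<le> n \<Longrightarrow> G (i, j) = G' (i, j)"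
  shows "(F, G) = (F', G')"
proof -
  have "F = F'"
    using nerve_PiE(1)[OF assms(1)] nerve_PiE(1)[OF assms(2)] by (rule PiE_ext) (simp add: assms(3))
  moreover have "G = G'"
    using nerve_PiE(2)[OF assms(1)] nerve_PiE(2)[OF assms(2)]
    by (rule PiE_ext) (auto simp: assms(4))
  ultimately show ?thesis
    by simp
qed

lemma nerve_eq_iff:
  assumes "(F, G) \<in> simplices (nerve C) n" "(F', G') \<in> simplices (nerve C) n"
  shows "(F, G) = (F', G') \<longleftrightarrow>
    (\<forall>i\<le>n. F i = F' i) \<and> (\<forall>i j. i \<le> j \<longrightarrow> j \<le> n \<longrightarrow> G (i, j) = G' (i, j))"
proof
  assume "(\<forall>i\<le>n. F i = F' i) \<and> (\<forall>i j. i \<le> j \<longrightarrow> j \<le> n \<longrightarrow> G (i, j) = G' (i, j))"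
  then show "(F, G) = (F', G')"
    by (intro nerve_eqI[OF assms]) auto
qed auto

section \<open>The nerve as a simplicial set\<close>

lemma delta_le: "f \<in> delta m n \<Longrightarrow> i \<le> m \<Longrightarrow> f i \<le> n"
  by (auto simp: delta_def)

lemma delta_mono: "f \<in> delta m n \<Longrightarrow> i \<le> j \<Longrightarrow> j \<le> m \<Longrightarrow> f i \<le> f j"
  by (auto simp: delta_def mono_on_def)

lemma act_nerve_closed:
  assumes f: "f \<in> delta m n" and x: "(F, G) \<in> simplices (nerve C) n"
  shows "act (nerve C) m n f (F, G) \<in> simplices (nerve C) m"
proof -
  let ?F = "\<lambda>i\<in>{..m}. F (f i)" and ?G = "\<lambda>(i, j)\<in>{(i, j). i \<le> j \<and> j \<le> m}. G (f i, f j)"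
  note f_simps = delta_le[OF f] delta_mono[OF f]
  have "?F \<in> {..m} \<rightarrow>\<^sub>E Obj C" "?G \<in> {(i, j). i \<le> j \<and> j \<le> m} \<rightarrow>\<^sub>E Mor C"
    by (auto simp: f_simps nerve_Obj[OF x] nerve_Mor[OF x])
  moreover have "Dom C (?G (i, j)) = ?F i \<and> Cod C (?G (i, j)) = ?F j" if "i \<le> j" "j \<le> m" for i j
    using that by (simp add: f_simps nerve_Dom[OF x] nerve_Cod[OF x])
  moreover have "?G (i, i) = Ident C (?F i)" if "i \<le> m" for i
    using that by (simp add: f_simps nerve_Ident[OF x])
  moreover have "?G (i, l) = Comp C (?G (j, l)) (?G (i, j))" if "i \<le> j" "j \<le> l" "l \<le> m" for i j l
    using that nerve_Comp[OF x, of "f i" "f j" "f l"] by (simp add: f_simps)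
  ultimately show ?thesis
    unfolding act_nerve simplices_nerve_iff by blast
qed

lemma simplicial_set_nerve: "simplicial_set (nerve C)"
proof
  fix m n f x
  assume "f \<in> delta m n" "x \<in> simplices (nerve C) n"
  then show "act (nerve C) m n f x \<in> simplices (nerve C) m"
    by (cases x) (simp add: act_nerve_closed)
next
  fix n x
  assume x: "x \<in> simplices (nerve C) n"
  obtain F G where FG: "x = (F, G)"
    by (cases x)
  have "(\<lambda>i\<in>{..n}. i) \<in> delta n n"
    by (auto simp: delta_def mono_on_def)
  then have "act (nerve C) n n (\<lambda>i\<in>{..n}. i) (F, G) \<in> simplices (nerve C) n"
    using x unfolding FG by (rule act_nerve_closed)
  then show "act (nerve C) n n (\<lambda>i\<in>{..n}. i) x = x"
    using x unfolding FG act_nerve by (rule nerve_eqI) auto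
next
  fix l m n f g x
  assume f: "f \<in> delta l m" and g: "g \<in> delta m n" and x: "x \<in> simplices (nerve C) n"
  obtain F G where FG: "x = (F, G)"
    by (cases x)
  show "act (nerve C) l n (compose {..l} g f) x =
      act (nerve C) l m f (act (nerve C) m n g x)"
    unfolding FG act_nerve using delta_le[OF f] delta_mono[OF f]
    by (auto intro!: restrict_ext simp: compose_eq)
qed

lemma src_nerve:
  "src (nerve C) n k (F, G) =
    (\<lambda>i\<in>{..k}. F i, \<lambda>(i, j)\<in>{(i, j). i \<le> j \<and> j \<le> k}. G (i, j))"
  by (auto simp: src_def act_nerve src_map_def restrict_def fun_eq_iff)

lemma tgt_nerve:
  "tgt (nerve C) n k (F, G) =
    (\<lambda>i\<in>{..k}. F (i + (n - k)),
     \<lambda>(i, j)\<in>{(i, j). i \<le> j \<and> j \<le> k}. G (i + (n - k), j + (n - k)))"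
  by (auto simp: tgt_def act_nerve tgt_map_def restrict_def fun_eq_iff)

lemma src_nerve_eq_iff:
  assumes "k \<le> n" "(F, G) \<in> simplices (nerve C) n" "(F', G') \<in> simplices (nerve C) k"
  shows "src (nerve C) n k (F, G) = (F', G') \<longleftrightarrow>
    (\<forall>i\<le>k. F i = F' i) \<and> (\<forall>i j. i \<le> j \<longrightarrow> j \<le> k \<longrightarrow> G (i, j) = G' (i, j))"
proof -
  have "src (nerve C) n k (F, G) \<in> simplices (nerve C) k"
    using assms by (intro simplicial_set.src_closed simplicial_set_nerve)
  then show ?thesis
    unfolding src_nerve by (subst nerve_eq_iff[OF _ assms(3)]) auto
qed

lemma tgt_nerve_eq_iff:
  assumes "k \<le> n" "(F, G) \<in> simplices (nerve C) n" "(F', G') \<in> simplices (nerve C) k"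
  shows "tgt (nerve C) n k (F, G) = (F', G') \<longleftrightarrow>
    (\<forall>i\<le>k. F (i + (n - k)) = F' i) \<and>
    (\<forall>i j. i \<le> j \<longrightarrow> j \<le> k \<longrightarrow> G (i + (n - k), j + (n - k)) = G' (i, j))"
proof -
  have "tgt (nerve C) n k (F, G) \<in> simplices (nerve C) k"
    using assms by (intro simplicial_set.tgt_closed simplicial_set_nerve)
  then show ?thesis
    unfolding tgt_nerve by (subst nerve_eq_iff[OF _ assms(3)]) auto
qed

section \<open>Unique glueing in the nerve\<close>

context small_category
begin

text \<open>There are \<open>d\<close> vertices before the overlap and \<open>e\<close> after it,
  which keeps truncated subtraction out of the statement. Arrows within either simplex are kept; an
  arrow that jumps over the overlap has to be a composite through one of its vertices.\<close>

lemma nerve_glue_exists: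
  assumes X: "(F, G) \<in> simplices (nerve C) (d + k)"
    and Y: "(F', G') \<in> simplices (nerve C) (k + e)"
    and overlap_obj: "\<And>i. i \<le> k \<Longrightarrow> F (i + d) = F' i"
    and overlap_mor: "\<And>i j. i \<le> j \<Longrightarrow> j \<le> k \<Longrightarrow> G (i + d, j + d) = G' (i, j)"
  shows "\<exists>H K. (H, K) \<in> simplices (nerve C) (d + k + e) \<and>
    (\<forall>i\<le>d + k. H i = F i) \<and> (\<forall>i j. i \<le> j \<longrightarrow> j \<le> d + k \<longrightarrow> K (i, j) = G (i, j)) \<and>
    (\<forall>i\<le>k + e. H (i + d) = F' i) \<and>
    (\<forall>i j. i \<le> j \<longrightarrow> j \<le> k + e \<longrightarrow> K (i + d, j + d) = G' (i, j))"
proof -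
  define m where "m = d + k"
  \<comment> \<open>Here \<open>n\<close> is the dimension of the glueing, not of the second
    simplex.\<close>
  define n where "n = d + k + e"
  have F: "F i \<in> Obj C" if "i \<le> m" for i
    using nerve_Obj[OF X] that by (simp add: m_def)
  have G: "G (i, j) \<in> Mor C" "Dom C (G (i, j)) = F i" "Cod C (G (i, j)) = F j"
    if "i \<le> j" "j \<le> m" for i j
    using that by (auto simp: m_def nerve_Mor[OF X] nerve_Dom[OF X] nerve_Cod[OF X])
  have G_id: "G (i, i) = Ident C (F i)" if "i \<le> m" for i
    using nerve_Ident[OF X] that by (simp add: m_def)
  have G_comp: "G (i, l) = Comp C (G (j, l)) (G (i, j))" if "i \<le> j" "j \<le> l" "l \<le> m" for i j l
    using that unfolding m_def by (rule nerve_Comp[OF X])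

  \<comment> \<open>The second simplex is shifted by \<open>d\<close> into the numbering of the
    glueing; the overlap is then \<open>d, ..., m\<close>.\<close>
  define F'' where "F'' i = F' (i - d)" for i
  define G'' where "G'' = (\<lambda>(i, j). G' (i - d, j - d))"
  have F'': "F'' i \<in> Obj C" if "d \<le> i" "i \<le> n" for i
    using that by (auto simp: n_def F''_def intro: nerve_Obj[OF Y])
  have G'': "G'' (i, j) \<in> Mor C" "Dom C (G'' (i, j)) = F'' i" "Cod C (G'' (i, j)) = F'' j"
    if "d \<le> i" "i \<le> j" "j \<le> n" for i j
  proof -
    have "i - d \<le> j - d" "j - d \<le> k + e"
      using that by (auto simp: n_def)
    then show "G'' (i, j) \<in> Mor C" "Dom C (G'' (i, j)) = F'' i" "Cod C (G'' (i, j)) = F'' j"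
      by (auto simp: F''_def G''_def nerve_Mor[OF Y] nerve_Dom[OF Y] nerve_Cod[OF Y])
  qed
  have G''_id: "G'' (i, i) = Ident C (F'' i)" if "d \<le> i" "i \<le> n" for i
    using that by (simp add: n_def F''_def G''_def nerve_Ident[OF Y])
  have G''_comp: "G'' (i, l) = Comp C (G'' (j, l)) (G'' (i, j))"
    if "d \<le> i" "i \<le> j" "j \<le> l" "l \<le> n" for i j l
    unfolding G''_def case_prod_conv using that by (intro nerve_Comp[OF Y]) (auto simp: n_def)
  have F_eq: "F'' i = F i" if "d \<le> i" "i \<le> m" for i
    using overlap_obj[of "i - d"] that by (simp add: m_def F''_def)
  have G_eq: "G'' (i, j) = G (i, j)" if "d \<le> i" "i \<le> j" "j \<le> m" for i j
    using overlap_mor[of "i - d" "j - d"] that by (simp add: m_def G''_def diff_le_mono)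
  have mn: "d \<le> m" "m \<le> n"
    by (auto simp: m_def n_def)

  define H where "H = (\<lambda>i\<in>{..n}. if i \<le> m then F i else F'' i)"
  \<comment> \<open>Arrows from before the overlap to after it pass through \<open>m\<close>, its
    last vertex.\<close>
  define K where "K = (\<lambda>(i, j)\<in>{(i, j). i \<le> j \<and> j \<le> n}.
    if j \<le> m then G (i, j) else if d \<le> i then G'' (i, j) else Comp C (G'' (m, j)) (G (i, m)))"
  have H_low: "H i = F i" if "i \<le> m" for i
    using that mn by (simp add: H_def)
  have H_high: "H i = F'' i" if "d \<le> i" "i \<le> n" for i
    using that F_eq by (simp add: H_def)
  have K_low: "K (i, j) = G (i, j)" if "i \<le> j" "j \<le> m" for i j
    using that mn by (simp add: K_def)
  have K_high: "K (i, j) = G'' (i, j)" if "d \<le> i" "i \<le> j" "j \<le> n" for i j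
    using that G_eq by (simp add: K_def)
  have m_eq: "F'' m = F m"
    using F_eq mn by simp
  \<comment> \<open>The factorisation through \<open>m\<close> also holds inside one simplex: by the
    identity law if \<open>j = m\<close>, by functoriality of the second simplex if
    \<open>d \<le> i\<close>. One formula thus covers all arrows across \<open>m\<close>.\<close>
  have K_mid: "K (i, j) = Comp C (G'' (m, j)) (G (i, m))" if "i \<le> m" "m \<le> j" "j \<le> n" for i j
  proof (cases "j \<le> m")
    case True
    then have "j = m"
      using that by simp
    then show ?thesis
      using that mn G[of i m] Comp_Ident_left[of "G (i, m)"] K_low[of i m] G''_id[of m] m_eq
      by simp
  next
    case False
    show ?thesis
    proof (cases "d \<le> i")
      case True
      then show ?thesis
        using that K_high[of i j] G''_comp[of i m j] G_eq[of i m] by simp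
    qed (use that False in \<open>simp add: K_def\<close>)
  qed
  have K: "K (i, j) \<in> Mor C \<and> Dom C (K (i, j)) = H i \<and> Cod C (K (i, j)) = H j"
    if "i \<le> j" "j \<le> n" for i j
  proof -
    consider "j \<le> m" | "m \<le> i" | "i \<le> m" "m \<le> j"
      by linarith
    then show ?thesis
    proof cases
      case 1
      then show ?thesis
        using that G[of i j] by (simp add: K_low H_low)
    next
      case 2
      then show ?thesis
        using that mn G''[of i j] by (simp add: K_high H_high)
    next
      case 3
      then show ?thesis
        using that mn G[of i m] G''[of m j] m_eq
        by (simp add: K_mid H_low H_high Comp_in_Mor Dom_Comp Cod_Comp)
    qed
  qed
  have K_id: "K (i, i) = Ident C (H i)" if "i \<le> n" for i
    using that mn G_id[of i] G''_id[of i] by (cases "i \<le> m") (auto simp: K_low K_high H_low H_high)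
  have K_comp: "K (i, l) = Comp C (K (j, l)) (K (i, j))" if "i \<le> j" "j \<le> l" "l \<le> n" for i j l
  proof -
    \<comment> \<open>The cases locate \<open>m\<close> relative to the chain
      \<open>i \<le> j \<le> l\<close>; associativity enters when \<open>m\<close> falls between two
      of its points.\<close>
    consider "l \<le> m" | "m \<le> i" | "i \<le> m" "m \<le> j" | "j \<le> m" "m \<le> l"
      using that by linarith
    then show ?thesis
    proof cases
      case 1
      then show ?thesis
        using that G_comp[of i j l] by (simp add: K_low)
    next
      case 2
      then show ?thesis
        using that mn G''_comp[of i j l] by (simp add: K_high)
    next
      case 3
      have "K (i, l) = Comp C (Comp C (G'' (j, l)) (G'' (m, j))) (G (i, m))"
        using that 3 mn G''_comp[of m j l] by (simp add: K_mid)
      also have "\<dots> = Comp C (G'' (j, l)) (Comp C (G'' (m, j)) (G (i, m)))"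
        using that 3 mn G[of i m] G''[of m j] G''[of j l] m_eq by (intro Comp_assoc[symmetric]) auto
      finally show ?thesis
        using that 3 mn by (simp add: K_mid K_high)
    next
      case 4
      have "K (i, l) = Comp C (G'' (m, l)) (Comp C (G (j, m)) (G (i, j)))"
        using that 4 mn G_comp[of i j m] by (simp add: K_mid)
      also have "\<dots> = Comp C (Comp C (G'' (m, l)) (G (j, m))) (G (i, j))"
        using that 4 mn G[of i j] G[of j m] G''[of m l] m_eq by (intro Comp_assoc) auto
      finally show ?thesis
        using that 4 mn by (simp add: K_mid K_low)
    qed
  qed
  have "H \<in> {..n} \<rightarrow>\<^sub>E Obj C"
    using F F'' mn by (auto simp: H_def)
  moreover have "K \<in> {(i, j). i \<le> j \<and> j \<le> n} \<rightarrow>\<^sub>E Mor C"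
  proof (rule PiE_I)
    fix ij assume "ij \<notin> {(i, j). i \<le> j \<and> j \<le> n}"
    then show "K ij = undefined"
      unfolding K_def by simp
  qed (use K in auto)
  ultimately have "(H, K) \<in> simplices (nerve C) n"
    unfolding simplices_nerve_iff using K K_id K_comp by blast
  moreover have "\<forall>i\<le>k + e. H (i + d) = F' i"
    by (auto simp: H_high n_def F''_def)
  moreover have "\<forall>i j. i \<le> j \<longrightarrow> j \<le> k + e \<longrightarrow> K (i + d, j + d) = G' (i, j)"
    by (auto simp: K_high n_def G''_def)
  ultimately show ?thesis
    using H_low K_low unfolding m_def n_def by blast
qed

text \<open>An arrow that lies in neither half factors through the vertex \<open>d + k\<close>, so
  it is determined by one arrow from each half.\<close>

lemma nerve_glue_unique:
  assumes "(F, G) \<in> simplices (nerve C) (d + k + e)" "(F', G') \<in> simplices (nerve C) (d + k + e)"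
    and low: "\<And>i. i \<le> d + k \<Longrightarrow> F i = F' i"
      "\<And>i j. i \<le> j \<Longrightarrow> j \<le> d + k \<Longrightarrow> G (i, j) = G' (i, j)"
    and high: "\<And>i. i \<le> k + e \<Longrightarrow> F (i + d) = F' (i + d)"
      "\<And>i j. i \<le> j \<Longrightarrow> j \<le> k + e \<Longrightarrow> G (i + d, j + d) = G' (i + d, j + d)"
  shows "(F, G) = (F', G')"
  using assms(1,2)
proof (rule nerve_eqI)
  fix i assume "i \<le> d + k + e"
  then show "F i = F' i"
    using low(1)[of i] high(1)[of "i - d"] by (cases "i \<le> d + k") auto
next
  fix i j assume ij: "i \<le> j" "j \<le> d + k + e"
  have high': "G (i, j) = G' (i, j)" if "d \<le> i" "i \<le> j" "j \<le> d + k + e" for i j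
    using high(2)[of "i - d" "j - d"] that by simp
  consider "j \<le> d + k" | "d \<le> i" | "i \<le> d + k" "d + k \<le> j"
    by linarith
  then show "G (i, j) = G' (i, j)"
  proof cases
    case 3
    have "G (i, j) = Comp C (G (d + k, j)) (G (i, d + k))"
      using 3 ij by (intro nerve_Comp[OF assms(1)])
    also have "\<dots> = Comp C (G' (d + k, j)) (G' (i, d + k))"
      using 3 ij low(2)[of i "d + k"] high'[of "d + k" j] by simp
    also have "\<dots> = G' (i, j)"
      using 3 ij by (intro nerve_Comp[OF assms(2), symmetric])
    finally show ?thesis .
  qed (use ij low(2) high' in auto)
qed

lemma gluing_sset_nerve: "gluing_sset (nerve C)"
proof (intro gluing_sset.intro gluing_sset_axioms.intro simplicial_set_nerve)
  fix k m n x y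
  assume k: "k \<le> m" "k \<le> n" and x: "x \<in> simplices (nerve C) m" and y: "y \<in> simplices (nerve C) n"
    and xy: "tgt (nerve C) m k x = src (nerve C) n k y"
  obtain d e where de: "m = d + k" "n = k + e"
    using k by (metis add.commute le_Suc_ex)
  obtain F G F' G' where FG: "x = (F, G)" "y = (F', G')"
    by (cases x, cases y)
  have X: "(F, G) \<in> simplices (nerve C) (d + k)" and Y: "(F', G') \<in> simplices (nerve C) (k + e)"
    using x y de FG by auto
  have eq: "(\<lambda>i\<in>{..k}. F (i + d)) = (\<lambda>i\<in>{..k}. F' i)"
    "(\<lambda>(i, j)\<in>{(i, j). i \<le> j \<and> j \<le> k}. G (i + d, j + d)) =
      (\<lambda>(i, j)\<in>{(i, j). i \<le> j \<and> j \<le> k}. G' (i, j))"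
    using xy by (simp_all add: FG de src_nerve tgt_nerve)
  have "F (i + d) = F' i" if "i \<le> k" for i
    using fun_cong[OF eq(1), of i] that by simp
  moreover have "G (i + d, j + d) = G' (i, j)" if "i \<le> j" "j \<le> k" for i j
    using fun_cong[OF eq(2), of "(i, j)"] that by simp
  ultimately obtain H K where HK: "(H, K) \<in> simplices (nerve C) (d + k + e)"
    "\<forall>i\<le>d + k. H i = F i" "\<forall>i j. i \<le> j \<longrightarrow> j \<le> d + k \<longrightarrow> K (i, j) = G (i, j)"
    "\<forall>i\<le>k + e. H (i + d) = F' i"
    "\<forall>i j. i \<le> j \<longrightarrow> j \<le> k + e \<longrightarrow> K (i + d, j + d) = G' (i, j)"
    using nerve_glue_exists[OF X Y] by blast
  \<comment> \<open>The second equation identifies the shift of the final face as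
    \<open>d\<close>.\<close>
  have j: "m + n - k = d + k + e" "d + k + e - (k + e) = d"
    using de by auto
  have S: "src (nerve C) (d + k + e) (d + k) (H, K) = (F, G) \<longleftrightarrow>
      (\<forall>i\<le>d + k. H i = F i) \<and> (\<forall>i j. i \<le> j \<longrightarrow> j \<le> d + k \<longrightarrow> K (i, j) = G (i, j))"
    if "(H, K) \<in> simplices (nerve C) (d + k + e)" for H K
    using src_nerve_eq_iff[OF _ that X] by simp
  have T: "tgt (nerve C) (d + k + e) (k + e) (H, K) = (F', G') \<longleftrightarrow>
      (\<forall>i\<le>k + e. H (i + d) = F' i) \<and>
      (\<forall>i j. i \<le> j \<longrightarrow> j \<le> k + e \<longrightarrow> K (i + d, j + d) = G' (i, j))"
    if "(H, K) \<in> simplices (nerve C) (d + k + e)" for H K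
    using tgt_nerve_eq_iff[OF _ that Y] unfolding j by simp
  show "\<exists>!z. z \<in> simplices (nerve C) (m + n - k) \<and> src (nerve C) (m + n - k) m z = x \<and>
      tgt (nerve C) (m + n - k) n z = y"
    unfolding j FG unfolding de
  proof (rule ex1I)
    show "(H, K) \<in> simplices (nerve C) (d + k + e) \<and>
        src (nerve C) (d + k + e) (d + k) (H, K) = (F, G) \<and>
        tgt (nerve C) (d + k + e) (k + e) (H, K) = (F', G')"
      using HK S[OF HK(1)] T[OF HK(1)] by blast
  next
    fix z
    assume z: "z \<in> simplices (nerve C) (d + k + e) \<and>
        src (nerve C) (d + k + e) (d + k) z = (F, G) \<and>
        tgt (nerve C) (d + k + e) (k + e) z = (F', G')"
    obtain H' K' where HK': "z = (H', K')"
      by (cases z)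
    then have "(H', K') \<in> simplices (nerve C) (d + k + e)"
      using z by simp
    then show "z = (H, K)"
      unfolding HK' using HK(1)
      by (rule nerve_glue_unique) (use z S[of H' K'] T[of H' K'] HK HK' in auto)
  qed
qed

end

theorem proposition3p28:
  fixes C :: "('o, 'm) cat"
  assumes "small_category C"
  shows "\<exists>comp. compository
           (dist_sset (nerve C) ::
              ((nat \<Rightarrow> 'o) \<times> (nat \<times> nat \<Rightarrow> 'm) \<Rightarrow> 'r::zero_sum_free_semifield) sset)
           comp"
  using gluing_sset.compository_dist_sset[OF small_category.gluing_sset_nerve[OF assms]] by blast

end
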